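(* Let $h\in\Bbbk[x]$ be monic of degree $N\geq 1$ with zero coefficient of $x^{N-1}$. Let $$\Delta(A_h)=\{\Delta_{s(x)}\mid s(x)\in\Bbbk[x],\ \deg(s(x))<\deg(h(x))\}\subseteq\operatorname{Der}(A_h)$$ and $\operatorname{Inn}(A_h)=\{ad_w\mid w\in A_h\}$. Then $\Delta(A_h)$ is an $\operatorname{Aut}(A_h)$-submodule of $\operatorname{Der}(A_h)$. Moreover, $\operatorname{Inn}(A_h)$ and $\Delta(A_h)$ are independent $\operatorname{Aut}(A_h)$-submodules of $\operatorname{Der}(A_h)$.
   Context: $\Bbbk$ is an algebraically closed field of characteristic zero. $A_h=\Bbbk[x][t;d]$, $d=h(x)\partial_x$, is the associative unital $\Bbbk$-algebra generated by $x,t$ subject to $tx=xt+h(x)$. $\operatorname{Aut}(A_h)$ and $\operatorname{Der}(A_h)$ denote $\Bbbk$-algebra automorphisms and $\Bbbk$-derivations; $\operatorname{Aut}(A_h)$ acts on $\operatorname{Der}(A_h)$ by $\rho\cdot\delta=\rho\delta\rho^{-1}$. An $\operatorname{Aut}(A_h)$-submodule is a $\Bbbk$-subspace stable under this action; two submodules are independent if their intersection is $0$. $ad_w(u)=wu-uw$. $\Delta_{s(x)}$ is the derivation of $A_h$ with $\Delta_{s(x)}(x)=0$, $\Delta_{s(x)}(t)=s(x)$. The degree of the zero polynomial is $-\infty$. For such $h$ it is known that every automorphism of $A_h$ is uniquely of the form $\sigma_{r(x)}\circ\tau_a$ with $r(x)\in\Bbbk[x]$ and $a\in\Bbbk^\ast$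 satisfying $h(ax)=a^Nh(x)$, where $\sigma_{r(x)}(x)=x$, $\sigma_{r(x)}(t)=t+r(x)$, $\tau_a(x)=ax$, $\tau_a(t)=a^{N-1}t$. *)

theory Defs
  imports
    "HOL-Computational_Algebra.Computational_Algebra"
    "HOL-Library.Function_Algebras"
begin

(*
  The Ore extension K[x][t;d] is realised on the type 'k poly poly: the outer variable is t and
  the coefficients from K[x] stand on the left, so that the polynomial with coefficients
  p_0, ..., p_n is p_0 + p_1 t + ... + p_n t^n.  The K-linear structure is the usual one; only
  the product is twisted.  Since the product depends on d, it is a function ore_mult and not an
  instance of the class times on a type.
*)

(* Left multiplication by t, given by t f = f t + d f for f in K[x]. *)
definition ore_shift :: "('k::field poly \<Rightarrow> 'k poly) \<Rightarrow> 'k poly poly \<Rightarrow> 'k poly poly" where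
  "ore_shift d q = pCons 0 q + map_poly d q"

definition ore_mult :: "('k::field poly \<Rightarrow> 'k poly) \<Rightarrow> 'k poly poly \<Rightarrow> 'k poly poly \<Rightarrow> 'k poly poly" where
  "ore_mult d p q = (\<Sum>i\<le>degree p. smult (coeff p i) ((ore_shift d ^^ i) q))"

definition A_mult :: "'k::field poly \<Rightarrow> 'k poly poly \<Rightarrow> 'k poly poly \<Rightarrow> 'k poly poly" where
  "A_mult h = ore_mult (\<lambda>f. h * pderiv f)"

abbreviation from_Kx :: "'k::field poly \<Rightarrow> 'k poly poly" where
  "from_Kx f \<equiv> [:f:]"

definition gen_x :: "'k::field poly poly" where
  "gen_x = from_Kx [:0, 1:]"

definition gen_t :: "'k::field poly poly" where
  "gen_t = [:0, 1:]"

definition scaleA :: "'k::field \<Rightarrow> 'k poly poly \<Rightarrow> 'k poly poly" where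
  "scaleA c u = smult [:c:] u"

(* Addition and zero of endomaps of A_h are the pointwise ones of Function_Algebras. *)
definition scaleEnd ::
  "'k::field \<Rightarrow> ('k poly poly \<Rightarrow> 'k poly poly) \<Rightarrow> ('k poly poly \<Rightarrow> 'k poly poly)" where
  "scaleEnd c \<delta> = (\<lambda>u. scaleA c (\<delta> u))"

definition Aut :: "'k::field poly \<Rightarrow> ('k poly poly \<Rightarrow> 'k poly poly) set" where
  "Aut h = {\<rho>. Vector_Spaces.linear scaleA scaleA \<rho> \<and> bij \<rho> \<and> \<rho> 1 = 1 \<and>
                (\<forall>u v. \<rho> (A_mult h u v) = A_mult h (\<rho> u) (\<rho> v))}"

definition Der :: "'k::field poly \<Rightarrow> ('k poly poly \<Rightarrow> 'k poly poly) set" where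
  "Der h = {\<delta>. Vector_Spaces.linear scaleA scaleA \<delta> \<and>
                (\<forall>u v. \<delta> (A_mult h u v) = A_mult h (\<delta> u) v + A_mult h u (\<delta> v))}"

definition Aut_act ::
  "('k::field poly poly \<Rightarrow> 'k poly poly) \<Rightarrow> ('k poly poly \<Rightarrow> 'k poly poly) \<Rightarrow>
   ('k poly poly \<Rightarrow> 'k poly poly)" where
  "Aut_act \<rho> \<delta> = \<rho> \<circ> \<delta> \<circ> inv \<rho>"

definition Aut_submodule :: "'k::field poly \<Rightarrow> ('k poly poly \<Rightarrow> 'k poly poly) set \<Rightarrow> bool" where
  "Aut_submodule h M \<longleftrightarrow>
     M \<subseteq> Der h \<and> module.subspace scaleEnd M \<and> (\<forall>\<rho>\<in>Aut h. \<forall>\<delta>\<in>M. Aut_act \<rho> \<delta> \<in> M)"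

definition independent_submodules ::
  "('k::field poly poly \<Rightarrow> 'k poly poly) set \<Rightarrow> ('k poly poly \<Rightarrow> 'k poly poly) set \<Rightarrow> bool" where
  "independent_submodules M M' \<longleftrightarrow> M \<inter> M' = {0}"

definition ad :: "'k::field poly \<Rightarrow> 'k poly poly \<Rightarrow> 'k poly poly \<Rightarrow> 'k poly poly" where
  "ad h w = (\<lambda>u. A_mult h w u - A_mult h u w)"

definition Inn :: "'k::field poly \<Rightarrow> ('k poly poly \<Rightarrow> 'k poly poly) set" where
  "Inn h = {ad h w | w. True}"

definition Delta_der :: "'k::field poly \<Rightarrow> 'k poly \<Rightarrow> 'k poly poly \<Rightarrow> 'k poly poly" where
  "Delta_der h s = (THE \<delta>. \<delta> \<in> Der h \<and> \<delta> gen_x = 0 \<and> \<delta> gen_t = from_Kx s)"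

(* degree 0 = 0 in the library, hence the separate case for the degree -infinity. *)
definition Delta :: "'k::field poly \<Rightarrow> ('k poly poly \<Rightarrow> 'k poly poly) set" where
  "Delta h = {Delta_der h s | s. s = 0 \<or> degree s < degree h}"

lemma vector_space_scaleA: "vector_space (scaleA :: 'k::field \<Rightarrow> _)"
  by unfold_locales
    (simp_all add: scaleA_def smult_add_right mult.commute flip: smult_add_left one_pCons)

lemma vector_space_scaleEnd: "vector_space (scaleEnd :: 'k::field \<Rightarrow> _)"
  by unfold_locales
    (simp_all add: scaleEnd_def fun_eq_iff plus_fun_def vector_space.vector_space_assms[OF vector_space_scaleA])

lemma ore_mult_0_left [simp]: "ore_mult d 0 q = 0"
  by (simp add: ore_mult_def)

lemma ore_mult_pCons:
  "ore_mult d (pCons a p) q = smult a q + ore_mult d p (ore_shift d q)"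
proof (cases "p = 0")
  case False
  have "ore_mult d (pCons a p) q =
      (\<Sum>i\<le>Suc (degree p). smult (coeff (pCons a p) i) ((ore_shift d ^^ i) q))"
    using False by (simp add: ore_mult_def)
  also have "\<dots> = smult a q + (\<Sum>i\<le>degree p. smult (coeff p i) ((ore_shift d ^^ Suc i) q))"
    by (subst sum.atMost_Suc_shift) simp
  finally show ?thesis by (simp add: ore_mult_def funpow_swap1)
qed (simp add: ore_mult_def)

lemma ore_mult_add_left: "ore_mult d (p + p') q = ore_mult d p q + ore_mult d p' q"
  by (induction p p' arbitrary: q rule: poly_induct2)
    (simp_all add: ore_mult_pCons smult_add_left algebra_simps)

lemma ore_mult_smult_left: "ore_mult d (smult a p) q = smult a (ore_mult d p q)"
  by (induction p arbitrary: q) (simp_all add: ore_mult_pCons smult_add_right)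

lemma coeff_ore_shift:
  "coeff (ore_shift (\<lambda>f. h * pderiv f) q) n =
     (case n of 0 \<Rightarrow> 0 | Suc m \<Rightarrow> coeff q m) + h * pderiv (coeff q n)"
  by (simp add: ore_shift_def coeff_map_poly coeff_pCons)

lemma ore_shift_add:
  "ore_shift (\<lambda>f. h * pderiv f) (q + q') =
     ore_shift (\<lambda>f. h * pderiv f) q + ore_shift (\<lambda>f. h * pderiv f) q'"
  by (rule poly_eqI) (simp add: coeff_ore_shift pderiv_add algebra_simps split: nat.splits)

lemma ore_shift_smult:
  "ore_shift (\<lambda>f. h * pderiv f) (smult f q) =
     smult f (ore_shift (\<lambda>f. h * pderiv f) q) + smult (h * pderiv f) q"
  by (rule poly_eqI) (simp add: coeff_ore_shift pderiv_mult algebra_simps split: nat.splits)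

lemma ore_shift_pCons:
  "ore_shift (\<lambda>f. h * pderiv f) (pCons a q) =
     pCons (h * pderiv a) ([:a:] + ore_shift (\<lambda>f. h * pderiv f) q)"
  by (rule poly_eqI) (simp add: coeff_ore_shift coeff_pCons split: nat.splits)

lemma ore_mult_add_right:
  "ore_mult (\<lambda>f. h * pderiv f) p (q + q') =
     ore_mult (\<lambda>f. h * pderiv f) p q + ore_mult (\<lambda>f. h * pderiv f) p q'"
  by (induction p arbitrary: q q') (simp_all add: ore_mult_pCons ore_shift_add smult_add_right)

lemma ore_mult_ore_shift:
  "ore_mult (\<lambda>f. h * pderiv f) (ore_shift (\<lambda>f. h * pderiv f) q) r =
     ore_shift (\<lambda>f. h * pderiv f) (ore_mult (\<lambda>f. h * pderiv f) q r)"
proof (induction q arbitrary: r)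
  case 0
  show ?case by (simp add: ore_shift_def)
next
  case (pCons a q)
  from pCons.IH show ?case
    by (simp add: ore_shift_pCons ore_mult_pCons ore_mult_add_left ore_shift_add ore_shift_smult
        add_ac)
qed

lemma ore_mult_assoc:
  "ore_mult (\<lambda>f. h * pderiv f) (ore_mult (\<lambda>f. h * pderiv f) p q) r =
     ore_mult (\<lambda>f. h * pderiv f) p (ore_mult (\<lambda>f. h * pderiv f) q r)"
  by (induction p arbitrary: q)
    (simp_all add: ore_mult_pCons ore_mult_add_left ore_mult_smult_left ore_mult_ore_shift)

lemma A_mult_assoc: "A_mult h (A_mult h u v) w = A_mult h u (A_mult h v w)"
  by (simp add: A_mult_def ore_mult_assoc)

lemma A_mult_add_left: "A_mult h (u + v) w = A_mult h u w + A_mult h v w"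
  by (simp add: A_mult_def ore_mult_add_left)

lemma A_mult_add_right: "A_mult h u (v + w) = A_mult h u v + A_mult h u w"
  by (simp add: A_mult_def ore_mult_add_right)

lemma A_mult_from_Kx: "A_mult h (from_Kx f) u = smult f u"
  by (simp add: A_mult_def ore_mult_pCons)

lemma A_mult_1_left: "A_mult h 1 u = u"
  using A_mult_from_Kx[of h 1 u] by (metis one_pCons smult_1_left)

lemma A_mult_gen_t: "A_mult h gen_t u = pCons 0 u + map_poly (\<lambda>f. h * pderiv f) u"
  by (simp add: A_mult_def gen_t_def ore_mult_pCons ore_shift_def)

lemma A_mult_1_right: "A_mult h u 1 = u"
proof -
  have shift: "ore_shift (\<lambda>f. h * pderiv f) (monom 1 n) = monom 1 (Suc n)" for n
    by (rule poly_eqI) (auto simp: coeff_ore_shift split: nat.splits)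
  have "(ore_shift (\<lambda>f. h * pderiv f) ^^ n) 1 = monom 1 n" for n
    by (induction n) (simp_all add: shift)
  thus ?thesis
    by (simp add: A_mult_def ore_mult_def smult_monom poly_as_sum_of_monoms)
qed

lemma A_mult_scaleA_left: "A_mult h (scaleA c u) v = scaleA c (A_mult h u v)"
  by (simp add: A_mult_def scaleA_def ore_mult_smult_left)

lemma A_mult_scaleA_right: "A_mult h u (scaleA c v) = scaleA c (A_mult h u v)"
proof -
  let ?d = "\<lambda>f. h * pderiv f"
  have "ore_mult ?d u (smult [:c:] v) = smult [:c:] (ore_mult ?d u v)"
    by (induction u arbitrary: v)
      (simp_all add: ore_mult_pCons ore_shift_smult smult_add_right pderiv_pCons mult.commute)
  thus ?thesis by (simp add: A_mult_def scaleA_def)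
qed

lemma gen_t_gen_x: "A_mult h gen_t gen_x = A_mult h gen_x gen_t + from_Kx h"
  by (simp only: A_mult_gen_t gen_x_def A_mult_from_Kx)
    (simp add: map_poly_pCons pderiv_pCons gen_t_def)

end

theory Submission
  imports Defs
begin

text \<open>
  All commutators of \<open>A\<^sub>h\<close> lie in \<open>h A\<^sub>h\<close>, because modulo \<open>h\<close> the twisted product is the commutative
  one. Hence an automorphism \<open>\<rho>\<close> sends \<open>h = [t,x]\<close> to \<open>h u\<close>, and applying this to the inverse of
  \<open>\<rho>\<close> shows that \<open>u\<close> is a unit, i.e. a nonzero scalar. Comparing degrees in \<open>t\<close> in
  \<open>h(\<rho>(x)) = u h\<close> gives \<open>\<rho>(x) \<in> K[x]\<close>, which then has degree one; the leading term of
  \<open>[\<rho>(t), \<rho>(x)] = u h\<close> gives \<open>\<rho>(t) = c t + q(x)\<close> with a scalar \<open>c\<close>. Conjugation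
  by such a map turns \<open>\<Delta>\<^sub>s\<close> into a derivation of the same form with \<open>s\<close> replaced by a scalar
  multiple of \<open>s(\<rho>(x))\<close>. If \<open>ad\<^sub>w = \<Delta>\<^sub>s\<close>, then \<open>w\<close> commutes with
  \<open>x\<close>, so \<open>w \<in> K[x]\<close> and \<open>s = - h w'\<close>, which forces \<open>s = 0\<close> when \<open>deg s < deg h\<close>.
\<close>

section \<open>Products, degrees and commutators\<close>

lemma A_mult_0_left [simp]: "A_mult h 0 u = 0"
  by (simp add: A_mult_def)

lemma A_mult_0_right [simp]: "A_mult h u 0 = 0"
  using A_mult_add_right[of h u 0 0] by (metis add_0 add_cancel_right_right)

lemma A_mult_diff_left: "A_mult h (u - v) w = A_mult h u w - A_mult h v w"
  using A_mult_add_left[of h "u - v" v w] by (simp add: algebra_simps)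

lemma A_mult_diff_right: "A_mult h u (v - w) = A_mult h u v - A_mult h u w"
  using A_mult_add_right[of h u "v - w" w] by (simp add: algebra_simps)

lemma A_mult_smult_left: "A_mult h (smult f u) v = smult f (A_mult h u v)"
  by (simp add: A_mult_def ore_mult_smult_left)

lemma A_mult_pCons:
  "A_mult h (pCons a p) q = smult a q + A_mult h p (A_mult h gen_t q)"
  by (simp add: A_mult_def gen_t_def ore_mult_pCons)

lemma A_mult_gen_t_pCons:
  "A_mult h gen_t (pCons a q) = pCons (h * pderiv a) (from_Kx a + A_mult h gen_t q)"
  by (simp add: A_mult_def gen_t_def ore_mult_pCons ore_shift_pCons)

text \<open>Associativity in disguise: coefficients stand on the left, so right multiplication by
  \<open>t\<close> is the plain shift \<open>pCons 0\<close> and meets no coefficient that would be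
  differentiated.\<close>

lemma A_mult_pCons_0_right: "A_mult h u (pCons 0 v) = pCons 0 (A_mult h u v)"
  by (induction u arbitrary: v) (simp_all add: A_mult_pCons A_mult_gen_t_pCons)

lemma A_mult_gen_t_right:
  fixes h :: "'k::field poly"
  shows "A_mult h u gen_t = pCons 0 u"
proof -
  have "A_mult h u gen_t = A_mult h u (pCons 0 1)" by (simp add: gen_t_def one_pCons)
  also have "\<dots> = pCons 0 u" unfolding A_mult_pCons_0_right A_mult_1_right ..
  finally show ?thesis .
qed

text \<open>Splits off a factor \<open>t\<close> on the right, so that induction over
  \<open>pCons\<close> applies to maps obeying a law for products.\<close>

lemma pCons_eq_A_mult: "pCons a p = from_Kx a + A_mult h p gen_t"
  by (simp add: A_mult_gen_t_right)

text \<open>A Horner step written with operations that derivations and automorphisms respect. It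
  holds for every \<open>h\<close>, since a left factor from \<open>K[x]\<close> multiplies without
  a twist.\<close>

lemma from_Kx_pCons: "from_Kx (pCons c f) = scaleA c 1 + A_mult h gen_x (from_Kx f)"
  by (simp add: gen_x_def A_mult_from_Kx scaleA_def)

text \<open>This is \<open>t f = f t + h f'\<close> multiplied by \<open>p\<close> from the left,
  with \<open>f'\<close> the derivative of \<open>f\<close>.\<close>

lemma A_mult_pCons_from_Kx:
  "A_mult h (pCons a p) (from_Kx f) =
     from_Kx (a * f) + pCons 0 (A_mult h p (from_Kx f)) + A_mult h p (from_Kx (h * pderiv f))"
proof -
  have t: "A_mult h gen_t (from_Kx f) = pCons 0 (from_Kx f) + from_Kx (h * pderiv f)"
    by (simp add: A_mult_gen_t_pCons)
  show ?thesis
    by (simp only: A_mult_pCons t A_mult_add_right A_mult_pCons_0_right) (simp add: add.assoc)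
qed

section \<open>Degree in \<open>t\<close> and units\<close>

lemma degree_lead_coeff_A_mult_gen_t:
  assumes "q \<noteq> 0"
  shows "degree (A_mult h gen_t q) = Suc (degree q) \<and> lead_coeff (A_mult h gen_t q) = lead_coeff q"
proof -
  have c: "coeff (A_mult h gen_t q) n = (case n of 0 \<Rightarrow> 0 | Suc m \<Rightarrow> coeff q m) + h * pderiv (coeff q n)" for n
    using coeff_ore_shift[of h q n] by (simp add: A_mult_def gen_t_def ore_mult_pCons)
  have "degree (A_mult h gen_t q) = Suc (degree q)"
  proof (rule antisym)
    show "degree (A_mult h gen_t q) \<le> Suc (degree q)"
      by (rule degree_le) (auto simp: c coeff_eq_0 split: nat.splits)
    show "Suc (degree q) \<le> degree (A_mult h gen_t q)"
      using assms by (intro le_degree) (simp add: c coeff_eq_0)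
  qed
  thus ?thesis by (simp add: c coeff_eq_0)
qed

text \<open>Moving \<open>t\<close> past a coefficient changes only terms of lower degree in
  \<open>t\<close>, and \<open>K[x]\<close> is a domain, so leading terms multiply as in the
  commutative case.\<close>

lemma degree_lead_coeff_A_mult:
  assumes "p \<noteq> 0" "q \<noteq> 0"
  shows "degree (A_mult h p q) = degree p + degree q \<and>
    lead_coeff (A_mult h p q) = lead_coeff p * lead_coeff q"
  using assms
proof (induction p arbitrary: q)
  case (pCons a p)
  show ?case
  proof (cases "p = 0")
    case True
    with pCons show ?thesis by (simp add: A_mult_pCons)
  next
    case False
    let ?tq = "A_mult h gen_t q"
    have tq: "degree ?tq = Suc (degree q)" "lead_coeff ?tq = lead_coeff q"
      using degree_lead_coeff_A_mult_gen_t[OF pCons.prems(2), of h] by blast+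
    hence "?tq \<noteq> 0" by auto
    hence IH: "degree (A_mult h p ?tq) = Suc (degree p + degree q)"
      "lead_coeff (A_mult h p ?tq) = lead_coeff p * lead_coeff q"
      using pCons.IH[OF False, of ?tq] tq by auto
    have "degree (smult a q) < degree (A_mult h p ?tq)"
      using IH(1) degree_smult_le[of a q] by linarith
    thus ?thesis
      using False IH by (simp add: A_mult_pCons degree_add_eq_right coeff_eq_0 tq)
  qed
qed simp

lemma degree_A_mult: "p \<noteq> 0 \<Longrightarrow> q \<noteq> 0 \<Longrightarrow> degree (A_mult h p q) = degree p + degree q"
  using degree_lead_coeff_A_mult by blast

text \<open>Degrees in \<open>t\<close> add up to zero, so both factors lie in \<open>K[x]\<close>,
  whose units are the nonzero constants.\<close>

lemma A_mult_eq_1D: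
  assumes "A_mult h u v = 1"
  obtains c where "c \<noteq> 0" "u = from_Kx [:c:]"
proof -
  have nz: "u \<noteq> 0" "v \<noteq> 0" using assms by auto
  have "degree u + degree v = 0" using degree_A_mult[OF nz, of h] assms by simp
  then obtain f g where u: "u = from_Kx f" and v: "v = from_Kx g"
    by (metis add_is_0 degree_0_id)
  hence "f * g = 1" using assms by (simp add: A_mult_from_Kx one_pCons)
  hence "f dvd 1" by (metis dvd_triv_left)
  moreover have "f \<noteq> 0" using nz u by auto
  ultimately have "degree f = 0" by (simp add: is_unit_iff_degree)
  then obtain c where c: "f = [:c:]" by (rule degree_eq_zeroE)
  with \<open>f \<noteq> 0\<close> have "c \<noteq> 0" by auto
  with c u show thesis using that by blast
qed

section \<open>Commutators: divisibility by \<open>h\<close> and leading terms\<close>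

text \<open>Here \<open>*\<close> and \<open>dvd\<close> refer to the commutative product on iterated polynomials.\<close>

lemma dvd_A_mult_diff_times: "from_Kx h dvd A_mult h u v - u * v"
proof (induction u arbitrary: v)
  case (pCons a p)
  let ?w = "map_poly pderiv v"
  \<comment> \<open>Modulo \<open>h\<close>, left multiplication by \<open>t\<close> is the shift,
    which is also commutative multiplication by \<open>t\<close>.\<close>
  have t: "A_mult h gen_t v = pCons 0 v + from_Kx h * ?w"
    unfolding A_mult_gen_t by (rule poly_eqI) (simp add: coeff_map_poly coeff_pCons)
  have "A_mult h (pCons a p) v - pCons a p * v =
      (A_mult h p (A_mult h gen_t v) - p * A_mult h gen_t v) + from_Kx h * (p * ?w)"
    by (simp add: A_mult_pCons t algebra_simps)
  thus ?case using pCons.IH by (metis dvd_add dvd_triv_left)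
qed simp

lemma dvd_commutator: "from_Kx h dvd A_mult h u v - A_mult h v u"
proof -
  have "A_mult h u v - A_mult h v u = (A_mult h u v - u * v) - (A_mult h v u - v * u)"
    by (simp add: mult.commute)
  thus ?thesis using dvd_A_mult_diff_times by (metis dvd_diff)
qed

lemma coeff_A_mult_from_Kx_top:
  "degree p \<le> n \<Longrightarrow> coeff (A_mult h p (from_Kx f)) n = coeff p n * f"
proof (induction p arbitrary: f n)
  case (pCons a p)
  show ?case
  proof (cases n)
    case 0
    with pCons.prems have "p = 0" by (simp split: if_splits)
    with 0 show ?thesis by (simp add: A_mult_pCons_from_Kx)
  next
    case (Suc m)
    with pCons.prems have d: "degree p \<le> m" by (simp split: if_splits)
    \<comment> \<open>The instance at \<open>m\<close> gives the main term; the one at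
      \<open>Suc m\<close> makes the derivative term vanish, because \<open>p\<close> has degree at
      most \<open>m\<close>.\<close>
    thus ?thesis
      using Suc pCons.IH[of m] pCons.IH[of "Suc m"]
      by (simp add: A_mult_pCons_from_Kx coeff_pCons coeff_eq_0)
  qed
qed simp

text \<open>The second term of the expansion
  \<open>t^(n+1) f = f t^(n+1) + (n+1) h f' t^n + ...\<close>.\<close>

lemma coeff_A_mult_from_Kx_subtop:
  "degree p \<le> Suc n \<Longrightarrow> coeff (A_mult h p (from_Kx f)) n =
     coeff p n * f + of_nat (Suc n) * coeff p (Suc n) * h * pderiv f"
proof (induction p arbitrary: f n)
  case (pCons a p)
  show ?case
  proof (cases n)
    case 0
    with pCons.prems have "degree p \<le> 0" by (simp split: if_splits)
    with 0 show ?thesis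
      by (simp add: A_mult_pCons_from_Kx coeff_A_mult_from_Kx_top)
  next
    case (Suc m)
    with pCons.prems have d: "degree p \<le> Suc m" by (simp split: if_splits)
    \<comment> \<open>The induction hypothesis yields the factor \<open>Suc m\<close> before
      \<open>h f'\<close>; the top coefficient of \<open>p\<close> times \<open>h f'\<close> adds
      one more copy.\<close>
    thus ?thesis
      using Suc pCons.IH[OF d, of f] coeff_A_mult_from_Kx_top[OF d, of h "h * pderiv f"]
      by (simp add: A_mult_pCons_from_Kx coeff_pCons algebra_simps)
  qed
qed simp

lemma coeff_commutator_from_Kx:
  fixes h :: "'k::field poly"
  assumes "degree w = Suc n"
  shows "coeff (A_mult h w (from_Kx f) - A_mult h (from_Kx f) w) n =
    of_nat (Suc n) * lead_coeff w * h * pderiv f"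
  using assms by (simp add: coeff_A_mult_from_Kx_subtop A_mult_from_Kx)

text \<open>All factors of the coefficient are nonzero; for the integer factor this is
  characteristic zero.\<close>

lemma coeff_commutator_from_Kx_nonzero:
  fixes h :: "'k::field_char_0 poly"
  assumes "degree w = Suc n" "h \<noteq> 0" "pderiv f \<noteq> 0"
  shows "coeff (A_mult h w (from_Kx f) - A_mult h (from_Kx f) w) n \<noteq> 0"
proof -
  have "w \<noteq> 0" using assms(1) by auto
  thus ?thesis
    unfolding coeff_commutator_from_Kx[OF assms(1)] using assms(2,3) by (simp del: of_nat_Suc)
qed

text \<open>The centraliser of \<open>x\<close> is \<open>K[x]\<close>: for positive degree in
  \<open>t\<close>, the commutator with \<open>x\<close> has a nonzero coefficient one below the
  top.\<close>

lemma commutes_gen_xD: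
  fixes h :: "'k::field_char_0 poly"
  assumes "h \<noteq> 0" "A_mult h w gen_x = A_mult h gen_x w"
  obtains f where "w = from_Kx f"
proof (cases "degree w")
  case 0
  thus thesis using that by (metis degree_0_id)
next
  case (Suc n)
  thus thesis
    using coeff_commutator_from_Kx_nonzero[OF Suc assms(1), of "[:0, 1:]"] assms(2)
    by (simp add: gen_x_def pderiv_pCons)
qed

section \<open>Derivations\<close>

lemma linear_scaleA_iff:
  "Vector_Spaces.linear scaleA scaleA f \<longleftrightarrow>
     (\<forall>u v. f (u + v) = f u + f v) \<and> (\<forall>c u. f (scaleA c u) = scaleA c (f u))"
  using vector_space_scaleA
  by (auto simp: Vector_Spaces.linear_def module_hom_def module_hom_axioms_def module_iff_vector_space)

lemma DerI:
  assumes "\<And>u v. \<delta> (u + v) = \<delta> u + \<delta> v" "\<And>c u. \<delta> (scaleA c u) = scaleA c (\<delta> u)"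
    "\<And>u v. \<delta> (A_mult h u v) = A_mult h (\<delta> u) v + A_mult h u (\<delta> v)"
  shows "\<delta> \<in> Der h"
  using assms by (simp add: Der_def linear_scaleA_iff)

lemma DerD:
  assumes "\<delta> \<in> Der h"
  shows Der_add: "\<delta> (u + v) = \<delta> u + \<delta> v"
    and Der_scaleA: "\<delta> (scaleA c u) = scaleA c (\<delta> u)"
    and Der_A_mult: "\<delta> (A_mult h u v) = A_mult h (\<delta> u) v + A_mult h u (\<delta> v)"
  using assms by (simp_all add: Der_def linear_scaleA_iff)

lemma Der_0: "\<delta> \<in> Der h \<Longrightarrow> \<delta> 0 = 0"
  using Der_add[of \<delta> h 0 0] by (metis add_0 add_cancel_right_right)

lemma Der_1: "\<delta> \<in> Der h \<Longrightarrow> \<delta> 1 = 0"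
  by (metis A_mult_1_left A_mult_1_right Der_A_mult add_cancel_right_right)

lemma scaleA_0_right [simp]: "scaleA c 0 = 0"
  by (simp add: scaleA_def)

lemma scaleA_add: "scaleA c (u + v) = scaleA c u + scaleA c v"
  by (simp add: scaleA_def smult_add_right)

lemma scaleA_diff: "scaleA c (u - v) = scaleA c u - scaleA c v"
  by (simp add: scaleA_def smult_diff_right)

lemma scaleA_commute: "scaleA c (scaleA d u) = scaleA d (scaleA c u)"
  by (simp add: scaleA_def mult.commute)

lemma Der_from_Kx_eq_0:
  assumes "\<delta> \<in> Der h" "\<delta> gen_x = 0"
  shows "\<delta> (from_Kx f) = 0"
proof (induction f)
  case 0
  show ?case using Der_0[OF assms(1)] by simp
next
  case (pCons c f)
  thus ?case
    unfolding from_Kx_pCons[of c f h]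
    by (simp add: DerD[OF assms(1)] Der_1[OF assms(1)] assms(2))
qed

text \<open>The elements \<open>x\<close> and \<open>t\<close> generate the algebra: Horner steps
  reach all of \<open>K[x]\<close>, and right multiplication by \<open>t\<close> reaches the
  rest.\<close>

lemma Der_eqI:
  assumes D: "\<delta> \<in> Der h" "\<epsilon> \<in> Der h"
    and x: "\<delta> gen_x = \<epsilon> gen_x" and t: "\<delta> gen_t = \<epsilon> gen_t"
  shows "\<delta> = \<epsilon>"
proof
  have f: "\<delta> (from_Kx f) = \<epsilon> (from_Kx f)" for f
  proof (induction f)
    case 0
    show ?case by (simp add: Der_0[OF D(1)] Der_0[OF D(2)])
  next
    case (pCons c f)
    thus ?case
      unfolding from_Kx_pCons[of c f h]
      by (simp add: DerD[OF D(1)] DerD[OF D(2)] Der_1[OF D(1)] Der_1[OF D(2)] x)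
  qed
  show "\<delta> u = \<epsilon> u" for u
  proof (induction u)
    case 0
    show ?case by (simp add: Der_0[OF D(1)] Der_0[OF D(2)])
  next
    case (pCons a p)
    thus ?case
      unfolding pCons_eq_A_mult[of a p h]
      by (simp add: DerD[OF D(1)] DerD[OF D(2)] f t)
  qed
qed

section \<open>Existence and uniqueness of the derivations \<open>\<Delta>\<^sub>s\<close>\<close>

text \<open>\<open>Delta_pow h s n\<close> is \<open>\<Delta>\<^sub>s(t\<^sup>n)\<close>, as dictated by the product rule for \<open>t\<^sup>n t\<close>.\<close>

primrec Delta_pow :: "'k::field poly \<Rightarrow> 'k poly \<Rightarrow> nat \<Rightarrow> 'k poly poly" where
  "Delta_pow h s 0 = 0"
| "Delta_pow h s (Suc n) = pCons 0 (Delta_pow h s n) + A_mult h (monom 1 n) (from_Kx s)"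

text \<open>The left \<open>K[x]\<close>-linear extension from the powers of \<open>t\<close>,
  forced because \<open>\<Delta>\<^sub>s\<close> has to kill \<open>K[x]\<close>.\<close>

definition Delta_map :: "'k::field poly \<Rightarrow> 'k poly \<Rightarrow> 'k poly poly \<Rightarrow> 'k poly poly" where
  "Delta_map h s u = (\<Sum>i\<le>degree u. smult (coeff u i) (Delta_pow h s i))"

lemma Delta_map_eq:
  assumes "degree u \<le> n"
  shows "Delta_map h s u = (\<Sum>i\<le>n. smult (coeff u i) (Delta_pow h s i))"
  unfolding Delta_map_def using assms
  by (intro sum.mono_neutral_left) (auto simp: coeff_eq_0)

lemma Delta_map_add: "Delta_map h s (u + v) = Delta_map h s u + Delta_map h s v"
proof -
  let ?n = "max (degree u) (degree v)"
  have "degree (u + v) \<le> ?n" by (rule degree_add_le_max)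
  thus ?thesis
    by (simp add: Delta_map_eq[of _ ?n] smult_add_left sum.distrib)
qed

lemma smult_sum_right: "smult f (\<Sum>i\<in>B. g i) = (\<Sum>i\<in>B. smult f (g i))"
  by (induction B rule: infinite_finite_induct) (simp_all add: smult_add_right)

lemma Delta_map_smult: "Delta_map h s (smult f u) = smult f (Delta_map h s u)"
  by (simp add: Delta_map_eq[of "smult f u" "degree u"] Delta_map_eq[of u "degree u"]
      degree_smult_le smult_sum_right)

lemma Delta_map_0 [simp]: "Delta_map h s 0 = 0"
  by (simp add: Delta_map_def)

lemma Delta_map_from_Kx [simp]: "Delta_map h s (from_Kx f) = 0"
  by (simp add: Delta_map_def)

lemma A_mult_eq_sum:
  assumes "degree p \<le> n"
  shows "A_mult h p v = (\<Sum>i\<le>n. smult (coeff p i) (A_mult h (monom 1 i) v))"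
proof -
  have s: "A_mult h (sum g B) v = (\<Sum>i\<in>B. A_mult h (g i) v)" if "finite B" for g :: "nat \<Rightarrow> _" and B
    using that by (induction B rule: finite_induct) (simp_all add: A_mult_add_left)
  have "p = (\<Sum>i\<le>n. smult (coeff p i) (monom 1 i))"
    using assms by (simp add: smult_monom poly_as_sum_of_monoms')
  hence "A_mult h p v = A_mult h (\<Sum>i\<le>n. smult (coeff p i) (monom 1 i)) v" by simp
  thus ?thesis by (simp add: s A_mult_smult_left)
qed

lemma pCons_0_sum: "pCons 0 (\<Sum>i\<in>B. smult (f i) (g i)) = (\<Sum>i\<in>B. smult (f i) (pCons 0 (g i)))"
  by (rule poly_eqI) (simp add: coeff_sum coeff_pCons split: nat.splits)

lemma Delta_map_pCons:
  "Delta_map h s (pCons a p) = pCons 0 (Delta_map h s p) + A_mult h p (from_Kx s)"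
proof -
  have "degree (pCons a p) \<le> Suc (degree p)" by simp
  hence "Delta_map h s (pCons a p) =
      (\<Sum>i\<le>Suc (degree p). smult (coeff (pCons a p) i) (Delta_pow h s i))"
    by (rule Delta_map_eq)
  also have "\<dots> = (\<Sum>i\<le>degree p. smult (coeff p i) (Delta_pow h s (Suc i)))"
    by (subst sum.atMost_Suc_shift) simp
  also have "\<dots> = pCons 0 (Delta_map h s p) + A_mult h p (from_Kx s)"
    by (simp add: smult_add_right sum.distrib Delta_map_def pCons_0_sum
        A_mult_eq_sum[OF order_refl, of h p "from_Kx s"])
  finally show ?thesis .
qed

text \<open>The product rule for the left factor \<open>t\<close>. With left
  \<open>K[x]\<close>-linearity it is all that the induction for a general left factor
  needs.\<close>

lemma Delta_map_gen_t_mult: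
  "Delta_map h s (A_mult h gen_t v) = smult s v + A_mult h gen_t (Delta_map h s v)"
proof (induction v)
  case (pCons a q)
  have "Delta_map h s (A_mult h gen_t (pCons a q)) =
      pCons 0 (smult s q + A_mult h gen_t (Delta_map h s q)) + smult a (from_Kx s)
      + A_mult h (A_mult h gen_t q) (from_Kx s)"
    using pCons.IH
    by (simp add: A_mult_gen_t_pCons Delta_map_pCons Delta_map_add A_mult_add_left A_mult_from_Kx)
  also have "\<dots> = smult s (pCons a q) + A_mult h gen_t (Delta_map h s (pCons a q))"
    by (simp add: Delta_map_pCons A_mult_add_right A_mult_pCons_0_right A_mult_assoc mult.commute)
  finally show ?case .
qed simp

lemma Delta_map_A_mult:
  "Delta_map h s (A_mult h u v) = A_mult h (Delta_map h s u) v + A_mult h u (Delta_map h s v)"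
proof (induction u arbitrary: v)
  case (pCons a p)
  show ?case
    using pCons.IH[of "A_mult h gen_t v"]
    by (simp add: A_mult_pCons Delta_map_add Delta_map_smult Delta_map_gen_t_mult Delta_map_pCons
        A_mult_add_left A_mult_add_right A_mult_assoc A_mult_from_Kx)
qed simp

lemma Delta_map_in_Der: "Delta_map h s \<in> Der h"
  by (rule DerI) (simp_all add: Delta_map_add scaleA_def Delta_map_smult Delta_map_A_mult)

lemma Delta_map_gen_t: "Delta_map h s gen_t = from_Kx s"
  by (simp add: gen_t_def Delta_map_pCons A_mult_from_Kx)

text \<open>Existence by the explicit map and uniqueness by \<open>Der_eqI\<close> justify the
  definite description.\<close>

lemma Delta_der_eq_Delta_map: "Delta_der h s = Delta_map h s"
  unfolding Delta_der_def
  by (rule the_equality)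
    (auto intro: Der_eqI simp: Delta_map_in_Der Delta_map_gen_t gen_x_def)

lemma Delta_der_in_Der: "Delta_der h s \<in> Der h"
  by (simp add: Delta_der_eq_Delta_map Delta_map_in_Der)

lemma Delta_der_gen_x: "Delta_der h s gen_x = 0"
  by (simp add: Delta_der_eq_Delta_map gen_x_def)

lemma Delta_der_gen_t: "Delta_der h s gen_t = from_Kx s"
  by (simp add: Delta_der_eq_Delta_map Delta_map_gen_t)

lemma Delta_der_eqI:
  assumes "\<delta> \<in> Der h" "\<delta> gen_x = 0" "\<delta> gen_t = from_Kx s"
  shows "\<delta> = Delta_der h s"
  using Der_eqI[OF assms(1) Delta_der_in_Der, of s] assms(2,3)
  by (simp add: Delta_der_gen_x Delta_der_gen_t)

section \<open>Subspaces of derivations\<close>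

lemma subspace_scaleEnd_iff:
  "module.subspace scaleEnd M \<longleftrightarrow>
     0 \<in> M \<and> (\<forall>\<delta>\<in>M. \<forall>\<epsilon>\<in>M. \<delta> + \<epsilon> \<in> M) \<and> (\<forall>c. \<forall>\<delta>\<in>M. scaleEnd c \<delta> \<in> M)"
  using module.subspace_def[OF vector_space_scaleEnd[unfolded module_iff_vector_space[symmetric]]] .

lemma Der_zero: "0 \<in> Der h"
  by (rule DerI) simp_all

lemma Der_plus: "\<delta> \<in> Der h \<Longrightarrow> \<epsilon> \<in> Der h \<Longrightarrow> \<delta> + \<epsilon> \<in> Der h"
  by (rule DerI)
    (simp_all add: DerD[of \<delta> h] DerD[of \<epsilon> h] scaleA_add A_mult_add_left A_mult_add_right algebra_simps)

lemma Der_scaleEnd: "\<delta> \<in> Der h \<Longrightarrow> scaleEnd c \<delta> \<in> Der h"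
  by (rule DerI)
    (simp_all add: scaleEnd_def DerD[of \<delta> h] scaleA_add scaleA_commute A_mult_scaleA_left A_mult_scaleA_right)

lemma subspace_Delta:
  fixes h :: "'k::field poly"
  shows "module.subspace scaleEnd (Delta h)"
proof -
  have "(0 :: 'k poly poly \<Rightarrow> _) = Delta_der h 0"
    by (rule Delta_der_eqI) (simp_all add: Der_zero)
  moreover have "Delta_der h s + Delta_der h s' = Delta_der h (s + s')" for s s'
    by (rule Delta_der_eqI) (simp_all add: Der_plus Delta_der_in_Der Delta_der_gen_x Delta_der_gen_t)
  moreover have "scaleEnd c (Delta_der h s) = Delta_der h (smult c s)" for c s
    by (rule Delta_der_eqI[OF Der_scaleEnd[OF Delta_der_in_Der]])
      (simp_all add: scaleEnd_def Delta_der_gen_x Delta_der_gen_t scaleA_def)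
  moreover have "s + s' = 0 \<or> degree (s + s') < degree h"
    if "s = 0 \<or> degree s < degree h" "s' = 0 \<or> degree s' < degree h" for s s' :: "'k poly"
    using that degree_add_less by auto
  moreover have "smult c s = 0 \<or> degree (smult c s) < degree h"
    if "s = 0 \<or> degree s < degree h" for s and c :: 'k
    using that by auto
  ultimately show ?thesis
    unfolding subspace_scaleEnd_iff Delta_def by blast
qed

lemma ad_in_Der: "ad h w \<in> Der h"
  by (rule DerI)
    (simp_all add: ad_def A_mult_add_left A_mult_add_right A_mult_scaleA_left A_mult_scaleA_right
      scaleA_diff A_mult_diff_left A_mult_diff_right A_mult_assoc)

lemma subspace_Inn:
  fixes h :: "'k::field poly"
  shows "module.subspace scaleEnd (Inn h)"
proof -
  have "(0 :: 'k poly poly \<Rightarrow> _) = ad h 0"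
    by (simp add: ad_def fun_eq_iff)
  moreover have "ad h w + ad h w' = ad h (w + w')" for w w'
    by (simp add: ad_def fun_eq_iff A_mult_add_left A_mult_add_right)
  moreover have "scaleEnd c (ad h w) = ad h (scaleA c w)" for c w
    by (simp add: ad_def scaleEnd_def fun_eq_iff scaleA_diff A_mult_scaleA_left A_mult_scaleA_right)
  ultimately show ?thesis
    unfolding subspace_scaleEnd_iff Inn_def by fast
qed

section \<open>Automorphisms\<close>

lemma AutD:
  assumes "\<rho> \<in> Aut h"
  shows Aut_add: "\<rho> (u + v) = \<rho> u + \<rho> v"
    and Aut_scaleA: "\<rho> (scaleA c u) = scaleA c (\<rho> u)"
    and Aut_A_mult: "\<rho> (A_mult h u v) = A_mult h (\<rho> u) (\<rho> v)"
    and Aut_1: "\<rho> 1 = 1"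
    and Aut_bij: "bij \<rho>"
  using assms by (simp_all add: Aut_def linear_scaleA_iff)

lemma Aut_0: "\<rho> \<in> Aut h \<Longrightarrow> \<rho> 0 = 0"
  using Aut_add[of \<rho> h 0 0] by (metis add_0 add_cancel_right_right)

lemma Aut_diff: "\<rho> \<in> Aut h \<Longrightarrow> \<rho> (u - v) = \<rho> u - \<rho> v"
  using Aut_add[of \<rho> h "u - v" v] by (simp add: algebra_simps)

lemma Aut_inv_right: "\<rho> \<in> Aut h \<Longrightarrow> \<rho> (inv \<rho> u) = u"
  using Aut_bij bij_inv_eq_iff by metis

lemma Aut_inv_left: "\<rho> \<in> Aut h \<Longrightarrow> inv \<rho> (\<rho> u) = u"
  using Aut_bij bij_inv_eq_iff by metis

lemma Aut_inv:
  assumes "\<rho> \<in> Aut h"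
  shows "inv \<rho> \<in> Aut h"
proof -
  \<comment> \<open>Each law for \<open>inv \<rho>\<close> is checked after applying
    \<open>\<rho>\<close> to both sides.\<close>
  have eqI: "inv \<rho> u = v" if "u = \<rho> v" for u v
    using that Aut_inv_left[OF assms] by simp
  show ?thesis
    unfolding Aut_def linear_scaleA_iff
    by (auto intro!: eqI simp: AutD[OF assms] Aut_inv_right[OF assms] bij_imp_bij_inv)
qed

lemma Aut_act_in_Der:
  assumes "\<rho> \<in> Aut h" "\<delta> \<in> Der h"
  shows "Aut_act \<rho> \<delta> \<in> Der h"
  by (rule DerI)
    (simp_all add: Aut_act_def DerD[OF assms(2)] AutD[OF assms(1)] AutD[OF Aut_inv[OF assms(1)]]
      Aut_inv_right[OF assms(1)])

lemma Aut_act_ad: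
  assumes "\<rho> \<in> Aut h"
  shows "Aut_act \<rho> (ad h w) = ad h (\<rho> w)"
  by (simp add: Aut_act_def ad_def fun_eq_iff Aut_diff[OF assms] Aut_A_mult[OF assms]
      Aut_inv_right[OF assms])

section \<open>Images of \<open>h\<close>, \<open>x\<close> and \<open>t\<close> under an
  automorphism\<close>

lemma Aut_from_Kx_h:
  fixes h :: "'k::field poly"
  assumes "h \<noteq> 0" "\<rho> \<in> Aut h"
  obtains c where "c \<noteq> 0" "\<rho> (from_Kx h) = from_Kx (smult c h)"
proof -
  have *: "\<exists>u. \<phi> (from_Kx h) = smult h u" if "\<phi> \<in> Aut h" for \<phi>
  proof -
    have "from_Kx h = A_mult h gen_t gen_x - A_mult h gen_x gen_t"
      by (simp add: gen_t_gen_x)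
    hence "from_Kx h dvd \<phi> (from_Kx h)"
      using dvd_commutator[of h "\<phi> gen_t" "\<phi> gen_x"]
      by (simp add: Aut_diff[OF that] Aut_A_mult[OF that])
    thus ?thesis by (auto elim!: dvdE)
  qed
  obtain u where u: "\<rho> (from_Kx h) = smult h u" using *[OF assms(2)] by blast
  obtain v where v: "inv \<rho> (from_Kx h) = smult h v" using *[OF Aut_inv[OF assms(2)]] by blast
  \<comment> \<open>Applying \<open>\<rho>\<close> to \<open>inv \<rho> (h) = h v\<close> gives
    \<open>h = h u \<rho>(v)\<close>; cancelling \<open>h\<close> exhibits \<open>u\<close> as a
    unit.\<close>
  have "from_Kx h = \<rho> (A_mult h (from_Kx h) v)"
    using Aut_inv_right[OF assms(2), of "from_Kx h"] v by (simp add: A_mult_from_Kx)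
  also have "\<dots> = smult h (A_mult h u (\<rho> v))"
    by (simp add: Aut_A_mult[OF assms(2)] u A_mult_smult_left)
  finally have "smult h (A_mult h u (\<rho> v)) = smult h 1" by (simp add: one_pCons)
  hence "smult h (A_mult h u (\<rho> v) - 1) = 0" by (simp add: smult_diff_right)
  hence "A_mult h u (\<rho> v) = 1" using assms(1) by simp
  then obtain c where "c \<noteq> 0" "u = from_Kx [:c:]" by (rule A_mult_eq_1D)
  thus thesis using that[of c] u by simp
qed

text \<open>Horner's scheme for \<open>f(\<rho>(x))\<close>: each step adds the positive degree of
  \<open>\<rho>(x)\<close> in \<open>t\<close>, so the scalar added afterwards cannot affect the
  degree.\<close>

lemma degree_Aut_from_Kx:
  fixes h :: "'k::field poly"
  assumes "\<rho> \<in> Aut h" "degree (\<rho> gen_x) > 0" "f \<noteq> 0"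
  shows "degree (\<rho> (from_Kx f)) = degree f * degree (\<rho> gen_x)"
  using assms(3)
proof (induction f)
  case (pCons c f)
  have step: "\<rho> (from_Kx (pCons c f)) = scaleA c 1 + A_mult h (\<rho> gen_x) (\<rho> (from_Kx f))"
    unfolding from_Kx_pCons[of c f h] by (simp add: AutD[OF assms(1)])
  have c1: "degree (scaleA c (1 :: 'k poly poly)) = 0"
    by (simp add: scaleA_def one_pCons)
  show ?case
  proof (cases "f = 0")
    case True
    with step c1 show ?thesis by (simp add: Aut_0[OF assms(1)])
  next
    case False
    have "\<rho> (from_Kx f) \<noteq> 0"
      using False Aut_inv_left[OF assms(1), of "from_Kx f"] Aut_0[OF Aut_inv[OF assms(1)]]
      by (metis pCons_eq_0_iff)
    moreover have "\<rho> gen_x \<noteq> 0" using assms(2) by auto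
    ultimately have d: "degree (A_mult h (\<rho> gen_x) (\<rho> (from_Kx f))) =
        degree (\<rho> gen_x) + degree f * degree (\<rho> gen_x)"
      using pCons.IH[OF False] by (simp add: degree_A_mult)
    show ?thesis
      using False assms(2) c1 d by (simp add: step degree_add_eq_right)
  qed
qed simp

lemma Aut_from_Kx_pcompose:
  assumes "\<rho> \<in> Aut h" "\<rho> gen_x = from_Kx p"
  shows "\<rho> (from_Kx f) = from_Kx (pcompose f p)"
proof (induction f)
  case 0
  show ?case using Aut_0[OF assms(1)] by simp
next
  case (pCons c f)
  thus ?case
    unfolding from_Kx_pCons[of c f h]
    by (simp add: AutD[OF assms(1)] assms(2) A_mult_from_Kx pcompose_pCons)
      (simp add: scaleA_def one_pCons)
qed

lemma Aut_gen_x: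
  fixes h :: "'k::field poly"
  assumes "degree h > 0" "\<rho> \<in> Aut h"
  obtains p where "\<rho> gen_x = from_Kx p" "degree p = 1"
proof -
  have h0: "h \<noteq> 0" using assms(1) by auto
  have *: "\<exists>p. \<phi> gen_x = from_Kx p" if \<phi>: "\<phi> \<in> Aut h" for \<phi>
  proof -
    obtain c where "\<phi> (from_Kx h) = from_Kx (smult c h)"
      using Aut_from_Kx_h[OF h0 \<phi>] by blast
    \<comment> \<open>Otherwise \<open>\<phi>(h)\<close> would have positive degree in
      \<open>t\<close>, namely a multiple of the degree of \<open>h\<close>, which is at least
      one.\<close>
    hence "degree (\<phi> gen_x) = 0"
      using degree_Aut_from_Kx[OF \<phi> _ h0] assms(1) by fastforce
    thus ?thesis by (metis degree_0_id)
  qed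
  obtain p where p: "\<rho> gen_x = from_Kx p" using *[OF assms(2)] by blast
  obtain q where q: "inv \<rho> gen_x = from_Kx q" using *[OF Aut_inv[OF assms(2)]] by blast
  \<comment> \<open>Since \<open>p\<close> and \<open>q\<close> come from mutually inverse
    automorphisms, \<open>q(p(x)) = x\<close>; degrees multiply under composition, which forces
    degree one.\<close>
  have "from_Kx (pcompose q p) = gen_x"
    using Aut_from_Kx_pcompose[OF assms(2) p, of q] Aut_inv_right[OF assms(2), of gen_x] q by simp
  hence "degree (pcompose q p) = 1" by (simp add: gen_x_def)
  hence "degree p = 1" by (simp add: degree_pcompose)
  with p show thesis using that by blast
qed

lemma Aut_gen_t:
  fixes h :: "'k::field_char_0 poly"
  assumes "degree h > 0" "\<rho> \<in> Aut h"
  obtains q c where "\<rho> gen_t = [:q, [:c:]:]"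
proof -
  have h0: "h \<noteq> 0" using assms(1) by auto
  obtain p where p: "\<rho> gen_x = from_Kx p" "degree p = 1"
    using Aut_gen_x[OF assms] .
  obtain u where u: "u \<noteq> 0" "\<rho> (from_Kx h) = from_Kx (smult u h)"
    using Aut_from_Kx_h[OF h0 assms(2)] .
  let ?w = "\<rho> gen_t"
  have "from_Kx h = A_mult h gen_t gen_x - A_mult h gen_x gen_t"
    by (simp add: gen_t_gen_x)
  hence comm: "A_mult h ?w (from_Kx p) - A_mult h (from_Kx p) ?w = from_Kx (smult u h)"
    using u(2) p(1) by (simp add: Aut_diff[OF assms(2)] Aut_A_mult[OF assms(2)])
  have p': "pderiv p \<noteq> 0" using p(2) by (simp add: pderiv_eq_0_iff)
  show thesis
  proof (cases "degree ?w")
    case 0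
    \<comment> \<open>Two elements of \<open>K[x]\<close> commute, contradicting that the commutator
      is a nonzero multiple of \<open>h\<close>.\<close>
    then obtain g where "?w = from_Kx g" by (metis degree_0_id)
    thus thesis using comm h0 u(1) by (simp add: A_mult_from_Kx mult.commute)
  next
    case (Suc n)
    \<comment> \<open>The commutator lies in \<open>K[x]\<close>, so its nonzero coefficient at
      \<open>n\<close> can only be the constant one.\<close>
    have "n = 0"
      using coeff_commutator_from_Kx_nonzero[OF Suc h0 p'] unfolding comm
      by (auto simp: coeff_pCons split: nat.splits)
    have "smult u h = of_nat (Suc n) * lead_coeff ?w * h * pderiv p"
      using coeff_commutator_from_Kx[OF Suc, of h p] \<open>n = 0\<close> unfolding comm by simp
    hence "h * [:u:] = h * (lead_coeff ?w * pderiv p)"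
      using \<open>n = 0\<close> by (simp add: mult_ac)
    hence "[:u:] = lead_coeff ?w * pderiv p" using h0 by (metis mult_cancel_left)
    hence "degree (lead_coeff ?w * pderiv p) = 0" by (metis degree_pCons_0)
    moreover have "?w \<noteq> 0" using Suc by auto
    ultimately have "degree (lead_coeff ?w) = 0" using p' by (simp add: degree_mult_eq)
    then obtain c where "lead_coeff ?w = [:c:]" by (metis degree_0_id)
    hence "?w = [:coeff ?w 0, [:c:]:]"
      using Suc \<open>n = 0\<close>
      by (intro poly_eqI) (auto simp: coeff_pCons coeff_eq_0 split: nat.splits)
    thus thesis using that by blast
  qed
qed

text \<open>The scalar \<open>c\<close> is the coefficient of \<open>t\<close> in
  \<open>inv \<rho> (t)\<close>, while \<open>p\<close> is \<open>\<rho>(x)\<close>: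
  \<open>\<Delta>\<^sub>s\<close> sends \<open>c t + q\<close> to \<open>c s\<close>, and
  \<open>\<rho>\<close> then substitutes \<open>p\<close> for \<open>x\<close>.\<close>

lemma Aut_act_Delta_der:
  fixes h :: "'k::field_char_0 poly"
  assumes "degree h > 0" "\<rho> \<in> Aut h"
  obtains c p where "degree p = 1" "Aut_act \<rho> (Delta_der h s) = Delta_der h (smult c (pcompose s p))"
proof -
  note D = Delta_der_in_Der[of h s]
  obtain p where p: "\<rho> gen_x = from_Kx p" "degree p = 1"
    using Aut_gen_x[OF assms] .
  obtain p' where p': "inv \<rho> gen_x = from_Kx p'"
    using Aut_gen_x[OF assms(1) Aut_inv[OF assms(2)]] by blast
  obtain q c where q: "inv \<rho> gen_t = [:q, [:c:]:]"
    using Aut_gen_t[OF assms(1) Aut_inv[OF assms(2)]] .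
  have "Aut_act \<rho> (Delta_der h s) gen_x = 0"
    by (simp add: Aut_act_def p' Der_from_Kx_eq_0[OF D Delta_der_gen_x] Aut_0[OF assms(2)])
  moreover have "Delta_der h s (inv \<rho> gen_t) = scaleA c (from_Kx s)"
    by (simp add: q Delta_der_eq_Delta_map Delta_map_pCons A_mult_from_Kx scaleA_def)
  hence "Aut_act \<rho> (Delta_der h s) gen_t = from_Kx (smult c (pcompose s p))"
    by (simp add: Aut_act_def Aut_scaleA[OF assms(2)] Aut_from_Kx_pcompose[OF assms(2) p(1)])
      (simp add: scaleA_def)
  ultimately have "Aut_act \<rho> (Delta_der h s) = Delta_der h (smult c (pcompose s p))"
    by (intro Delta_der_eqI Aut_act_in_Der[OF assms(2) D])
  with p(2) show thesis by (rule that)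
qed

section \<open>The two submodules and their independence\<close>

lemma Aut_submodule_Delta:
  fixes h :: "'k::field_char_0 poly"
  assumes "degree h > 0"
  shows "Aut_submodule h (Delta h)"
  unfolding Aut_submodule_def
proof (intro conjI ballI)
  show "Delta h \<subseteq> Der h" by (auto simp: Delta_def Delta_der_in_Der)
  show "module.subspace scaleEnd (Delta h)" by (rule subspace_Delta)
next
  fix \<rho> \<delta> assume \<rho>: "\<rho> \<in> Aut h" and "\<delta> \<in> Delta h"
  then obtain s where s: "\<delta> = Delta_der h s" "s = 0 \<or> degree s < degree h"
    by (auto simp: Delta_def)
  obtain c p where p: "degree p = 1" "Aut_act \<rho> \<delta> = Delta_der h (smult c (pcompose s p))"
    using Aut_act_Delta_der[OF assms \<rho>] s(1) by metis
  \<comment> \<open>Substituting a polynomial of degree one preserves the degree of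
    \<open>s\<close>.\<close>
  have "smult c (pcompose s p) = 0 \<or> degree (smult c (pcompose s p)) < degree h"
    using s(2) p(1) by (auto simp: degree_pcompose)
  thus "Aut_act \<rho> \<delta> \<in> Delta h" unfolding p(2) Delta_def by blast
qed

lemma Aut_submodule_Inn: "Aut_submodule h (Inn h)"
  unfolding Aut_submodule_def
proof (intro conjI ballI)
  show "Inn h \<subseteq> Der h" by (auto simp: Inn_def ad_in_Der)
  show "module.subspace scaleEnd (Inn h)" by (rule subspace_Inn)
  show "Aut_act \<rho> \<delta> \<in> Inn h" if "\<rho> \<in> Aut h" "\<delta> \<in> Inn h" for \<rho> \<delta>
    using that by (auto simp: Inn_def Aut_act_ad)
qed

lemma Inn_Int_Delta:
  fixes h :: "'k::field_char_0 poly"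
  assumes "h \<noteq> 0"
  shows "Inn h \<inter> Delta h = {0}"
proof (intro equalityI subsetI)
  fix \<delta> assume "\<delta> \<in> Inn h \<inter> Delta h"
  then obtain w s where w: "\<delta> = ad h w" and s: "\<delta> = Delta_der h s" "s = 0 \<or> degree s < degree h"
    unfolding Inn_def Delta_def by blast
  have "A_mult h w gen_x = A_mult h gen_x w"
    using Delta_der_gen_x[of h s] unfolding s(1)[symmetric] w by (simp add: ad_def)
  then obtain f where f: "w = from_Kx f" by (rule commutes_gen_xD[OF assms])
  have "ad h w gen_t = from_Kx (- (h * pderiv f))"
    by (simp add: ad_def f A_mult_from_Kx A_mult_gen_t_pCons gen_t_def[symmetric])
      (simp add: gen_t_def)
  hence "s = - (h * pderiv f)"
    using Delta_der_gen_t[of h s] unfolding s(1)[symmetric] w by simp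
  \<comment> \<open>If \<open>f'\<close> were nonzero, \<open>h f'\<close> would have degree at
    least that of \<open>h\<close>, against the bound on \<open>s\<close>.\<close>
  hence "s = 0" using s(2) assms
    by (cases "pderiv f = 0") (auto simp: degree_mult_eq)
  moreover have "Delta_der h 0 = 0"
    by (rule Delta_der_eqI[symmetric]) (simp_all add: Der_zero)
  ultimately show "\<delta> \<in> {0}" using s(1) by simp
next
  fix \<delta> :: "'k poly poly \<Rightarrow> 'k poly poly" assume "\<delta> \<in> {0}"
  thus "\<delta> \<in> Inn h \<inter> Delta h"
    using subspace_Inn[of h] subspace_Delta[of h] by (simp add: subspace_scaleEnd_iff)
qed

theorem lemma20:
  fixes h :: "'k::{alg_closed_field, field_char_0} poly"
  assumes "lead_coeff h = 1"
    and "degree h \<ge> 1"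
    and "coeff h (degree h - 1) = 0"
  shows "Aut_submodule h (Delta h) \<and>
    Aut_submodule h (Inn h) \<and>
    independent_submodules (Inn h) (Delta h)"
proof -
  have "degree h > 0" "h \<noteq> 0" using assms(2) by auto
  thus ?thesis
    by (simp add: independent_submodules_def Aut_submodule_Delta Aut_submodule_Inn Inn_Int_Delta)
qed

end
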